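(* Let $m\in\mathbb N$, $c\in(0,\infty)$, and let $u$ be a positive smooth solution on $(0,T)$ of the ODE $$c^2u''+u'=\frac1{2u}.$$ Let $\alpha(t)=\frac{u'(t)}{u(t)}$, and let $\beta$ be a smooth function such that $$c^2\dot\beta(t)=-\beta(t)+m\log u(t)+\frac m2\log(4\pi)-1,$$ with given initial datum $\beta(0)\in\mathbb R$. For $x\in\mathbb R^m$ and $t\in(0,T)$ let $$\rho(x,t)=\frac1{(4\pi u^2(t))^{m/2}}e^{-\frac{\|x\|^2}{4u^2(t)}},\qquad \phi(x,t)=\frac{\alpha(t)}2\|x\|^2+\beta(t).$$ Then $(\rho,\phi)$ satisfies on $\mathbb R^m\times(0,T)$ $$\partial_t\rho+\nabla\cdot(\rho\nabla\phi)=0,\qquad c^2\left(\partial_t\phi+\tfrac12|\nabla\phi|^2\right)=-\phi-\log\rho-1 .$$ *)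

theory Defs
  imports "HOL-Analysis.Analysis"
begin

text \<open>
  \<open>C\<^sup>\<infinity>\<close> functions on an open set \<open>S\<close> of reals. As \<open>S\<close> is open, each iterated derivative
  at a point of \<open>S\<close> depends only on the values of \<open>f\<close> on \<open>S\<close>.
\<close>
definition smooth_on_open :: "real set \<Rightarrow> (real \<Rightarrow> real) \<Rightarrow> bool" where
  "smooth_on_open S f \<longleftrightarrow> open S \<and> (\<forall>k. \<forall>t\<in>S. (deriv ^^ k) f differentiable (at t))"

text \<open>
  Differential operators in the space variable. As with \<^const>\<open>deriv\<close>, the values are
  meaningful only at points where the function is differentiable.
\<close>
definition grad :: "(real ^ 'm \<Rightarrow> real) \<Rightarrow> real ^ 'm \<Rightarrow> real ^ 'm" where
  "grad f x = (\<chi> i. frechet_derivative f (at x) (axis i 1))"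

definition divergence :: "(real ^ 'm \<Rightarrow> real ^ 'm) \<Rightarrow> real ^ 'm \<Rightarrow> real" where
  "divergence F x = (\<Sum>i\<in>UNIV. frechet_derivative F (at x) (axis i 1) $ i)"

end

theory Submission
  imports Defs
begin

text \<open>
  The pair \<open>(\<rho>, \<phi>)\<close> is the self-similar ansatz for the damped isothermal Euler system:
  \<open>\<rho>\<close> is a Gaussian of width \<open>u\<close>, and \<open>\<nabla>\<phi> = (u' / u) x\<close> is the velocity field of the
  dilation flow \<open>x \<mapsto> u(t) x\<close>.

  The continuity equation expresses that this flow transports the Gaussian profile. The
  derivative of a Gaussian in its width \<open>s\<close> is the Gaussian times \<open>\<parallel>x\<parallel>\<^sup>2 / (2 s\<^sup>3) - m / s\<close>, while
  the divergence of the Gaussian times the position field is the Gaussian times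
  \<open>m - \<parallel>x\<parallel>\<^sup>2 / (2 s\<^sup>2)\<close>, which is the former factor multiplied by \<open>- s\<close>.
  Multiplying by \<open>u'\<close> and by \<open>u' / u\<close>, respectively, makes the two terms cancel.

  In the second equation both sides are polynomials in \<open>\<parallel>x\<parallel>\<^sup>2\<close> of degree one, because
  \<open>ln \<rho> = - m ln u - (m / 2) ln (4 \<pi>) - \<parallel>x\<parallel>\<^sup>2 / (4 u\<^sup>2)\<close>.
  Since \<open>\<alpha>' + \<alpha>\<^sup>2 = u'' / u\<close>, comparing the coefficients of \<open>\<parallel>x\<parallel>\<^sup>2\<close> yields the equation for \<open>u\<close>
  divided by \<open>2 u\<close>, and comparing the constant terms yields the equation for \<open>\<beta>\<close>.
\<close>

lemma grad_eqI:
  assumes "(f has_derivative (\<lambda>h. g \<bullet> h)) (at x)"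
  shows "grad f x = g"
  by (simp add: grad_def vec_eq_iff inner_axis flip: frechet_derivative_at[OF assms])

lemma has_derivative_norm_power2:
  "((\<lambda>y. (norm y)\<^sup>2) has_derivative (\<lambda>h. (2 *\<^sub>R x) \<bullet> h)) (at (x :: 'a :: real_inner))"
  unfolding power2_norm_eq_inner
  by (auto intro!: derivative_eq_intros simp: inner_commute)

lemma has_derivative_scaled_position_field:
  assumes "(f has_derivative (\<lambda>h. g \<bullet> h)) (at x)"
  shows "((\<lambda>y. f y *\<^sub>R (a *\<^sub>R y)) has_derivative
           (\<lambda>h. f x *\<^sub>R (a *\<^sub>R h) + (g \<bullet> h) *\<^sub>R (a *\<^sub>R x))) (at x)"
  by (rule has_derivative_scaleR[OF assms]) (auto intro!: derivative_eq_intros)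

text \<open>
  The product rule for the divergence; the dimension appears because the identity field has
  divergence \<open>CARD('m)\<close>.
\<close>
lemma divergence_scaled_position_field:
  fixes x :: "real ^ 'm"
  assumes "(f has_derivative (\<lambda>h. g \<bullet> h)) (at x)"
  shows "divergence (\<lambda>y. f y *\<^sub>R (a *\<^sub>R y)) x = a * (real CARD('m) * f x + g \<bullet> x)"
proof -
  have "divergence (\<lambda>y. f y *\<^sub>R (a *\<^sub>R y)) x = (\<Sum>i\<in>UNIV. a * f x + a * (g $ i * x $ i))"
    unfolding divergence_def
      frechet_derivative_at[OF has_derivative_scaled_position_field[OF assms], symmetric]
    by (simp add: inner_axis) (simp add: axis_def algebra_simps)
  then show ?thesis
    by (simp add: sum.distrib inner_vec_def distrib_left flip: sum_distrib_left)
qed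

text \<open>The heat kernel at time \<open>s\<^sup>2\<close>, so that \<open>s\<close> measures the width of the profile.\<close>
definition gaussian :: "real \<Rightarrow> real ^ 'm \<Rightarrow> real" where
  "gaussian s x = 1 / (4 * pi * s\<^sup>2) powr (real CARD('m) / 2) * exp (- ((norm x)\<^sup>2 / (4 * s\<^sup>2)))"

text \<open>
  With the normalising factor in the exponent, the logarithm of the Gaussian is this exponent, and
  the logarithmic derivatives are the derivatives of the exponent.
\<close>
lemma gaussian_eq_exp:
  assumes "0 < s"
  shows "gaussian s (x :: real ^ 'm)
    = exp (- (real CARD('m) * ln s + real CARD('m) / 2 * ln (4 * pi) + (norm x)\<^sup>2 / (4 * s\<^sup>2)))"
proof -
  define k where "k = real CARD('m) * ln s + real CARD('m) / 2 * ln (4 * pi)"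
  have "ln (4 * pi * s\<^sup>2) = ln (4 * pi) + 2 * ln s"
    using assms ln_mult[of "4 * pi" "s\<^sup>2"] by (simp add: ln_realpow)
  then have "real CARD('m) / 2 * ln (4 * pi * s\<^sup>2) = k"
    unfolding k_def by (simp add: distrib_left)
  moreover have "4 * pi * s\<^sup>2 \<noteq> 0"
    using assms by simp
  ultimately have "(4 * pi * s\<^sup>2) powr (real CARD('m) / 2) = exp k"
    by (simp only: powr_def if_False)
  then have "gaussian s x = exp (- k) * exp (- ((norm x)\<^sup>2 / (4 * s\<^sup>2)))"
    by (simp only: gaussian_def exp_minus inverse_eq_divide)
  also have "\<dots> = exp (- (k + (norm x)\<^sup>2 / (4 * s\<^sup>2)))"
    by (simp only: mult_exp_exp minus_add_distrib)
  finally show ?thesis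
    unfolding k_def .
qed

lemma has_derivative_gaussian:
  fixes x :: "real ^ 'm"
  assumes "0 < s"
  shows "(gaussian s has_derivative (\<lambda>h. (- (gaussian s x / (2 * s\<^sup>2)) *\<^sub>R x) \<bullet> h)) (at x)"
proof -
  define k where "k = real CARD('m) * ln s + real CARD('m) / 2 * ln (4 * pi)"
  \<comment> \<open>The Gaussian is radial, so it suffices to differentiate in \<open>r = \<parallel>x\<parallel>\<^sup>2\<close>.\<close>
  have "((\<lambda>r. exp (- (k + r / (4 * s\<^sup>2)))) has_field_derivative
      exp (- (k + (norm x)\<^sup>2 / (4 * s\<^sup>2))) * - (1 / (4 * s\<^sup>2))) (at ((norm x)\<^sup>2))"
    by (intro DERIV_fun_exp DERIV_minus DERIV_cdivide DERIV_ident
        DERIV_add[OF DERIV_const, simplified])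
  from DERIV_compose_FDERIV[OF this has_derivative_norm_power2]
  have "(gaussian s has_derivative
      (\<lambda>h. (2 *\<^sub>R x) \<bullet> h * (gaussian s x * - (1 / (4 * s\<^sup>2))))) (at x)"
    unfolding gaussian_eq_exp[OF assms, abs_def] k_def .
  then show ?thesis
    by (rule has_derivative_eq_rhs) (simp add: fun_eq_iff)
qed

lemma has_field_derivative_gaussian_width:
  fixes x :: "real ^ 'm"
  assumes "0 < s"
  shows "((\<lambda>s. gaussian s x) has_field_derivative
           gaussian s x * ((norm x)\<^sup>2 / (2 * s ^ 3) - real CARD('m) / s)) (at s)"
proof -
  define k where "k = real CARD('m) / 2 * ln (4 * pi)"
  have gaussian_eq: "gaussian r x = exp (- (real CARD('m) * ln r + k + (norm x)\<^sup>2 / (4 * r\<^sup>2)))"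
    if "0 < r" for r
    unfolding k_def by (rule gaussian_eq_exp[OF that])
  have "((\<lambda>s. - (real CARD('m) * ln s + k + (norm x)\<^sup>2 / (4 * s\<^sup>2))) has_field_derivative
      (norm x)\<^sup>2 / (2 * s ^ 3) - real CARD('m) / s) (at s)"
    using assms
    by (auto intro!: derivative_eq_intros simp: field_simps power2_eq_square power3_eq_cube)
  from DERIV_fun_exp[OF this]
  have "((\<lambda>s. exp (- (real CARD('m) * ln s + k + (norm x)\<^sup>2 / (4 * s\<^sup>2)))) has_field_derivative
      gaussian s x * ((norm x)\<^sup>2 / (2 * s ^ 3) - real CARD('m) / s)) (at s)"
    by (simp only: gaussian_eq[OF assms])
  then show ?thesis
    by (rule has_field_derivative_transform_within_open[of _ _ _ "{0<..}"])
      (use assms in \<open>simp_all add: gaussian_eq\<close>)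
qed

text \<open>
  The velocity \<open>(v / s) x\<close> is that of the dilation flow when the width \<open>s\<close> grows at speed \<open>v\<close>,
  hence this is the continuity equation for the transported Gaussian.
\<close>
lemma gaussian_transported_by_dilation:
  fixes x :: "real ^ 'm"
  assumes "0 < s"
  shows "gaussian s x * ((norm x)\<^sup>2 / (2 * s ^ 3) - real CARD('m) / s) * v
           + divergence (\<lambda>y. gaussian s y *\<^sub>R ((v / s) *\<^sub>R y)) x = 0"
proof -
  have "divergence (\<lambda>y. gaussian s y *\<^sub>R ((v / s) *\<^sub>R y)) x
      = v / s * (real CARD('m) * gaussian s x - gaussian s x / (2 * s\<^sup>2) * (norm x)\<^sup>2)"
    unfolding divergence_scaled_position_field[OF has_derivative_gaussian[OF assms]]
    by (simp add: power2_norm_eq_inner)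
  moreover have "g * (n / (2 * s ^ 3) - m / s) * v + v / s * (m * g - g / (2 * s\<^sup>2) * n) = 0"
    for g n m :: real
    using assms by (simp add: field_simps power2_eq_square power3_eq_cube)
  ultimately show ?thesis
    by simp
qed

lemma smooth_on_open_DERIV:
  assumes "smooth_on_open S f" "t \<in> S"
  shows "(f has_field_derivative deriv f t) (at t)"
    and "(deriv f has_field_derivative deriv (deriv f) t) (at t)"
proof -
  have "(deriv ^^ k) f differentiable (at t)" for k
    using assms by (simp add: smooth_on_open_def)
  from this[of 0] this[of 1]
  show "(f has_field_derivative deriv f t) (at t)"
    and "(deriv f has_field_derivative deriv (deriv f) t) (at t)"
    by (simp_all add: DERIV_deriv_iff_real_differentiable)
qed

theorem theorem5p10:
  fixes c \<beta>\<^sub>0 :: real and T :: ereal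
    and u \<alpha> \<beta> :: "real \<Rightarrow> real"
    and \<rho> \<phi> :: "real ^ 'm \<Rightarrow> real \<Rightarrow> real"
  assumes c_pos: "0 < c" and T_pos: "0 < T"
    and u_pos: "\<forall>t\<in>einterval 0 T. 0 < u t"
    and u_smooth: "smooth_on_open (einterval 0 T) u"
    and u_ode: "\<forall>t\<in>einterval 0 T. c\<^sup>2 * deriv (deriv u) t + deriv u t = 1 / (2 * u t)"
    and \<alpha>_eq: "\<forall>t\<in>einterval 0 T. \<alpha> t = deriv u t / u t"
    and \<beta>_smooth: "smooth_on_open (einterval 0 T) \<beta>"
    and \<beta>_ode: "\<forall>t\<in>einterval 0 T.
          c\<^sup>2 * deriv \<beta> t
            = - \<beta> t + real CARD('m) * ln (u t) + real CARD('m) / 2 * ln (4 * pi) - 1"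
    and \<beta>_init: "\<beta> 0 = \<beta>\<^sub>0" "continuous (at_right 0) \<beta>"
    and \<rho>_eq: "\<forall>x. \<forall>t\<in>einterval 0 T.
          \<rho> x t = 1 / (4 * pi * (u t)\<^sup>2) powr (real CARD('m) / 2)
                    * exp (- ((norm x)\<^sup>2 / (4 * (u t)\<^sup>2)))"
    and \<phi>_eq: "\<forall>x. \<forall>t\<in>einterval 0 T. \<phi> x t = \<alpha> t / 2 * (norm x)\<^sup>2 + \<beta> t"
  shows "\<forall>x. \<forall>t\<in>einterval 0 T.
      \<rho> x differentiable (at t) \<and>
      \<phi> x differentiable (at t) \<and>
      (\<lambda>y. \<phi> y t) differentiable (at x) \<and>
      (\<lambda>y. \<rho> y t *\<^sub>R grad (\<lambda>z. \<phi> z t) y) differentiable (at x) \<and>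
      deriv (\<rho> x) t + divergence (\<lambda>y. \<rho> y t *\<^sub>R grad (\<lambda>z. \<phi> z t) y) x = 0 \<and>
      c\<^sup>2 * (deriv (\<phi> x) t + 1 / 2 * (norm (grad (\<lambda>z. \<phi> z t) x))\<^sup>2)
        = - \<phi> x t - ln (\<rho> x t) - 1"
proof (intro allI ballI)
  fix x :: "real ^ 'm" and t
  assume t: "t \<in> einterval 0 T"
  define m where "m = real CARD('m)"
  have opn: "open (einterval 0 T)"
    using u_smooth by (simp add: smooth_on_open_def)
  note pos = u_pos[rule_format, OF t]
  note du = smooth_on_open_DERIV[OF u_smooth t]
  have \<rho>: "\<rho> y s = gaussian (u s) y" if "s \<in> einterval 0 T" for y s
    using \<rho>_eq that by (simp add: gaussian_def)

  have \<rho>_t: "(\<rho> x has_field_derivative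
      gaussian (u t) x * ((norm x)\<^sup>2 / (2 * u t ^ 3) - m / u t) * deriv u t) (at t)"
    unfolding m_def
    using DERIV_chain2[where f = "\<lambda>s. gaussian s x",
        OF has_field_derivative_gaussian_width[OF pos] du(1)]
    by (rule has_field_derivative_transform_within_open[OF _ opn t]) (simp add: \<rho>)

  \<comment> \<open>The derivative is written with \<open>\<alpha>' = u'' / u - \<alpha>\<^sup>2\<close>, so that its second part cancels
    against \<open>\<bar>\<nabla>\<phi>\<bar>\<^sup>2 / 2\<close>.\<close>
  have "((\<lambda>s. deriv u s / u s / 2 * (norm x)\<^sup>2 + \<beta> s) has_field_derivative
      (deriv (deriv u) t / u t - (\<alpha> t)\<^sup>2) / 2 * (norm x)\<^sup>2 + deriv \<beta> t) (at t)"
    unfolding \<alpha>_eq[rule_format, OF t]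
    by (rule derivative_eq_intros du smooth_on_open_DERIV(1)[OF \<beta>_smooth t] refl
        | use pos in \<open>simp; fail\<close>)+
      (use pos in \<open>simp add: field_simps power2_eq_square\<close>)
  then have \<phi>_t: "(\<phi> x has_field_derivative
      (deriv (deriv u) t / u t - (\<alpha> t)\<^sup>2) / 2 * (norm x)\<^sup>2 + deriv \<beta> t) (at t)"
    by (rule has_field_derivative_transform_within_open[OF _ opn t]) (simp add: \<phi>_eq \<alpha>_eq)

  have \<phi>_x: "((\<lambda>z. \<phi> z t) has_derivative (\<lambda>h. (\<alpha> t *\<^sub>R y) \<bullet> h)) (at y)" for y
    using \<phi>_eq t by (auto intro!: derivative_eq_intros has_derivative_norm_power2)
  have flux: "(\<lambda>y. \<rho> y t *\<^sub>R grad (\<lambda>z. \<phi> z t) y)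
      = (\<lambda>y. gaussian (u t) y *\<^sub>R ((deriv u t / u t) *\<^sub>R y))"
    by (simp add: grad_eqI[OF \<phi>_x] \<rho>[OF t] \<alpha>_eq[rule_format, OF t])

  have continuity: "deriv (\<rho> x) t + divergence (\<lambda>y. \<rho> y t *\<^sub>R grad (\<lambda>z. \<phi> z t) y) x = 0"
    unfolding DERIV_imp_deriv[OF \<rho>_t] flux m_def
    by (rule gaussian_transported_by_dilation[OF pos])

  have "c\<^sup>2 * (deriv (\<phi> x) t + 1 / 2 * (norm (grad (\<lambda>z. \<phi> z t) x))\<^sup>2)
      = c\<^sup>2 * deriv (deriv u) t / (2 * u t) * (norm x)\<^sup>2 + c\<^sup>2 * deriv \<beta> t"
    unfolding DERIV_imp_deriv[OF \<phi>_t] grad_eqI[OF \<phi>_x]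
    by (simp add: power_mult_distrib algebra_simps add_divide_distrib diff_divide_distrib)
  also have "c\<^sup>2 * deriv (deriv u) t = 1 / (2 * u t) - deriv u t"
    using u_ode t by (simp add: eq_diff_eq)
  also have "c\<^sup>2 * deriv \<beta> t = - \<beta> t + m * ln (u t) + m / 2 * ln (4 * pi) - 1"
    using \<beta>_ode t by (simp add: m_def)
  also have "(1 / (2 * u t) - deriv u t) / (2 * u t) * (norm x)\<^sup>2 +
      (- \<beta> t + m * ln (u t) + m / 2 * ln (4 * pi) - 1) = - \<phi> x t - ln (\<rho> x t) - 1"
    using pos
    by (simp add: \<phi>_eq[rule_format, OF t] \<alpha>_eq[rule_format, OF t] \<rho>[OF t] gaussian_eq_exp
        m_def[symmetric] diff_divide_distrib left_diff_distrib power2_eq_square)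
  finally have hamilton_jacobi: "c\<^sup>2 * (deriv (\<phi> x) t + 1 / 2 * (norm (grad (\<lambda>z. \<phi> z t) x))\<^sup>2)
      = - \<phi> x t - ln (\<rho> x t) - 1" .

  have "(\<lambda>y. \<rho> y t *\<^sub>R grad (\<lambda>z. \<phi> z t) y) differentiable (at x)"
    unfolding flux
    using has_derivative_scaled_position_field[OF has_derivative_gaussian[OF pos]]
    by (rule differentiableI)
  moreover have "\<rho> x differentiable (at t)" "\<phi> x differentiable (at t)"
    using \<rho>_t \<phi>_t by (auto simp: real_differentiable_def)
  moreover have "(\<lambda>y. \<phi> y t) differentiable (at x)"
    using \<phi>_x by (rule differentiableI)
  ultimately show "\<rho> x differentiable (at t) \<and>
      \<phi> x differentiable (at t) \<and>
      (\<lambda>y. \<phi> y t) differentiable (at x) \<and>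
      (\<lambda>y. \<rho> y t *\<^sub>R grad (\<lambda>z. \<phi> z t) y) differentiable (at x) \<and>
      deriv (\<rho> x) t + divergence (\<lambda>y. \<rho> y t *\<^sub>R grad (\<lambda>z. \<phi> z t) y) x = 0 \<and>
      c\<^sup>2 * (deriv (\<phi> x) t + 1 / 2 * (norm (grad (\<lambda>z. \<phi> z t) x))\<^sup>2)
        = - \<phi> x t - ln (\<rho> x t) - 1"
    using continuity hamilton_jacobi by blast
qed

end
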